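(* For all integers $n\geq 3$, the recurrence relation \[(n+1)\,\mathrm{BoNa}_n(u)=(2n-1)(1+u)\,\mathrm{BoNa}_{n-1}(u)-(n-2)(u^2-6u+1)\,\mathrm{BoNa}_{n-2}(u)\] holds, where $\mathrm{BoNa}_m(u)=\sum_{k=1}^m \mathrm{BoNa}(m,k)u^k$ for every positive integer $m$.
   Context: A binary plane tree is a rooted plane tree on unlabeled vertices in which every non-leaf vertex has one or two children, and every child is a left child or a right child, even if it is the only child of its parent. A 0-1-tree is a binary plane tree in which every vertex that has two children is labeled 0 or 1 (no other vertex is labeled). A right edge is an edge connecting a vertex to its right child. For $n\ge 1$, the Boolean-Narayana number $\mathrm{BoNa}(n,k)$ is the number of 0-1-trees on $n$ vertices that have exactly $k-1$ right edges. *)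

theory Defs
  imports "HOL-Library.Tree" "HOL-Computational_Algebra.Polynomial"
begin

(* Binary plane trees are represented by the library type of binary trees: every Node is a
   vertex, and Leaf stands for an absent child, so a vertex with a single child still knows
   whether this child is a left or a right one.  The number of vertices is size t.  The
   annotation of a vertex is its label: None if it is unlabeled, Some False for the label 0,
   Some True for the label 1. *)

fun zero_one_tree :: "bool option tree \<Rightarrow> bool" where
  "zero_one_tree Leaf \<longleftrightarrow> True"
| "zero_one_tree (Node l a r) \<longleftrightarrow>
     (a \<noteq> None \<longleftrightarrow> l \<noteq> Leaf \<and> r \<noteq> Leaf) \<and> zero_one_tree l \<and> zero_one_tree r"

fun right_edges :: "'a tree \<Rightarrow> nat" where
  "right_edges Leaf = 0"
| "right_edges (Node l a r) =
     right_edges l + right_edges r + (if r = Leaf then 0 else 1)"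

(* The condition "exactly k - 1 right edges" is written without the truncated subtraction,
   so that BoNa n 0 = 0.  Meaningful for n >= 1: Leaf is the only tree of size 0. *)

definition BoNa :: "nat \<Rightarrow> nat \<Rightarrow> nat" where
  "BoNa n k = card {t. zero_one_tree t \<and> size t = n \<and> right_edges t + 1 = k}"

definition BoNa_poly :: "nat \<Rightarrow> int poly" where
  "BoNa_poly m = (\<Sum>k=1..m. monom (int (BoNa m k)) k)"

end

(* Splitting a tree at its root shows that the generating function B of the polynomials satisfies
   B = z (u + (1 + u) B + 2 B^2).  Completing the square, F = 4 z B - 1 + (1 + u) z is a square root
   of D = 1 - 2 (1 + u) z + (u^2 - 6 u + 1) z^2.  Differentiating F^2 = D and cancelling F gives
   2 D F' = D' F, and comparing coefficients of z^n gives the recurrence. *)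
theory Submission
  imports Defs "HOL-Computational_Algebra.Formal_Power_Series"
begin

section \<open>Decomposition at the root\<close>

definition zero_one_trees :: "nat \<Rightarrow> bool option tree set" where
  "zero_one_trees n = {t. zero_one_tree t \<and> size t = n}"

text \<open>The shift by one makes the weight of a tree counted by BoNa(n,k) equal to u^k. It also
  makes weights multiply at a root with two children: the edge to the right child supplies the
  second \<open>+ 1\<close>.\<close>

definition tree_weight :: "'a tree \<Rightarrow> int poly" where
  "tree_weight t = monom 1 (right_edges t + 1)"

lemma finite_trees_size_le: "finite {t :: 'a::finite tree. size t \<le> n}"
proof (induction n)
  case 0
  have "{t :: 'a tree. size t \<le> 0} = {Leaf}" by auto
  then show ?case by simp
next
  case (Suc n)
  let ?S = "{t :: 'a tree. size t \<le> n}"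
  have "{t :: 'a tree. size t \<le> Suc n}
      \<subseteq> insert Leaf ((\<lambda>(l, a, r). Node l a r) ` (?S \<times> UNIV \<times> ?S))"
  proof
    fix t :: "'a tree"
    assume "t \<in> {t. size t \<le> Suc n}"
    then show "t \<in> insert Leaf ((\<lambda>(l, a, r). Node l a r) ` (?S \<times> UNIV \<times> ?S))"
      by (cases t) (auto simp: image_iff)
  qed
  then show ?case by (rule finite_subset) (use Suc in auto)
qed

lemma finite_zero_one_trees: "finite (zero_one_trees n)"
  by (rule finite_subset[OF _ finite_trees_size_le[of n]]) (auto simp: zero_one_trees_def)

text \<open>Each right edge is determined by its lower end, which is never the root. This bounds the
  exponents by the range of summation in \<open>BoNa_poly\<close>.\<close>

lemma right_edges_less_size: "t \<noteq> Leaf \<Longrightarrow> right_edges t < size t"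
proof (induction t)
  case (Node l a r)
  then show ?case by (cases "l = Leaf"; cases "r = Leaf") auto
qed simp

text \<open>Trees are grouped by their number of right edges. Size 0 has to be excluded:
  \<open>Leaf\<close> has weight u, whereas \<open>BoNa_poly 0\<close> is an empty sum.\<close>

lemma BoNa_poly_eq_sum_weight:
  assumes "n \<ge> 1"
  shows "BoNa_poly n = (\<Sum>t\<in>zero_one_trees n. tree_weight t)"
proof -
  have "(\<Sum>t\<in>zero_one_trees n. tree_weight t)
      = (\<Sum>k=1..n. \<Sum>t\<in>{t\<in>zero_one_trees n. right_edges t + 1 = k}. tree_weight t)"
  proof (rule sum.group[symmetric])
    show "(\<lambda>t. right_edges t + 1) ` zero_one_trees n \<subseteq> {1..n}"
    proof clarify
      fix t assume t: "t \<in> zero_one_trees n"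
      then have "t \<noteq> Leaf" using assms by (auto simp: zero_one_trees_def)
      then show "right_edges t + 1 \<in> {1..n}"
        using t right_edges_less_size[of t] by (simp add: zero_one_trees_def)
    qed
  qed (auto simp: finite_zero_one_trees)
  also have "\<dots> = (\<Sum>k=1..n. monom (int (BoNa n k)) k)"
  proof (rule sum.cong)
    fix k
    have "(\<Sum>t\<in>{t\<in>zero_one_trees n. right_edges t + 1 = k}. tree_weight t)
        = (\<Sum>t\<in>{t\<in>zero_one_trees n. right_edges t + 1 = k}. monom 1 k)"
      by (rule sum.cong) (auto simp: tree_weight_def)
    also have "\<dots> = of_nat (BoNa n k) * monom 1 k"
      by (simp add: BoNa_def zero_one_trees_def conj_assoc)
    also have "\<dots> = monom (int (BoNa n k)) k"
      by (simp add: of_nat_poly smult_monom)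
    finally show "(\<Sum>t\<in>{t\<in>zero_one_trees n. right_edges t + 1 = k}. tree_weight t)
        = monom (int (BoNa n k)) k" .
  qed simp
  finally show ?thesis by (simp add: BoNa_poly_def)
qed

text \<open>With at least two vertices the root has only a left child, only a right child, or both.
  In the last case \<open>i\<close> is the size of the left subtree; it is carried along so that the
  index set is a nested \<open>SIGMA\<close> over which sums can be split.\<close>

lemma zero_one_trees_Suc:
  assumes "n \<ge> 1"
  shows "zero_one_trees (Suc n) =
      (\<lambda>l. Node l None Leaf) ` zero_one_trees n \<union> (\<lambda>r. Node Leaf None r) ` zero_one_trees n \<union>
      (\<lambda>(i, b, l, r). Node l (Some b) r) `
        (SIGMA i:{1..<n}. UNIV \<times> zero_one_trees i \<times> zero_one_trees (n - i))"
    (is "_ = ?L \<union> ?R \<union> ?M")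
proof (intro set_eqI iffI)
  fix t assume t: "t \<in> zero_one_trees (Suc n)"
  then obtain l a r where lar: "t = Node l a r"
    by (cases t) (auto simp: zero_one_trees_def)
  show "t \<in> ?L \<union> ?R \<union> ?M"
  proof (cases a)
    case None
    then show ?thesis using t lar by (auto simp: zero_one_trees_def)
  next
    case (Some b)
    then have "l \<noteq> Leaf" "r \<noteq> Leaf" using t lar by (auto simp: zero_one_trees_def)
    then have "size l > 0" "size r > 0" by (auto simp: neq_Leaf_iff)
    with t lar Some
    have "(size l, b, l, r) \<in> (SIGMA i:{1..<n}. UNIV \<times> zero_one_trees i \<times> zero_one_trees (n - i))"
      by (auto simp: zero_one_trees_def)
    then have "(\<lambda>(i :: nat, b, l, r). Node l (Some b) r) (size l, b, l, r) \<in> ?M"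
      by (rule imageI)
    then have "t \<in> ?M" using lar Some by simp
    then show ?thesis by blast
  qed
next
  fix t assume "t \<in> ?L \<union> ?R \<union> ?M"
  then show "t \<in> zero_one_trees (Suc n)"
    using assms by (auto simp: zero_one_trees_def)
qed

lemma BoNa_poly_0: "BoNa_poly 0 = 0"
  by (simp add: BoNa_poly_def)

lemma BoNa_poly_1: "BoNa_poly 1 = [:0, 1:]"
proof -
  have "zero_one_trees 1 = {Node Leaf None Leaf}"
  proof (intro set_eqI iffI)
    fix t assume "t \<in> zero_one_trees 1"
    then show "t \<in> {Node Leaf None Leaf}"
      by (cases t) (auto simp: zero_one_trees_def)
  qed (auto simp: zero_one_trees_def)
  then show ?thesis
    by (simp add: BoNa_poly_eq_sum_weight tree_weight_def monom_Suc)
qed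

text \<open>A lone left child keeps the weight, a lone right child adds one right edge and hence a
  factor u, and two children multiply their weights, with two possible labels of the root giving the
  factor 2.\<close>

lemma BoNa_poly_Suc:
  assumes "n \<ge> 1"
  shows "BoNa_poly (Suc n) =
      [:1, 1:] * BoNa_poly n + 2 * (\<Sum>i=0..n. BoNa_poly i * BoNa_poly (n - i))"
proof -
  define Z where "Z = zero_one_trees"
  define w where "w = (tree_weight :: bool option tree \<Rightarrow> int poly)"
  let ?L = "(\<lambda>l. Node l None Leaf) ` Z n"
  let ?R = "(\<lambda>r. Node Leaf None r) ` Z n"
  let ?S = "SIGMA i:{1..<n}. (UNIV :: bool set) \<times> Z i \<times> Z (n - i)"
  let ?f = "\<lambda>(i :: nat, b, l, r). Node l (Some b) r"
  have fin: "finite (Z i)" for i by (simp add: Z_def finite_zero_one_trees)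
  have nonLeaf: "t \<noteq> Leaf" if "t \<in> Z i" "i \<ge> 1" for t i
    using that by (auto simp: Z_def zero_one_trees_def)
  have wB: "(\<Sum>t\<in>Z i. w t) = BoNa_poly i" if "i \<ge> 1" for i
    using BoNa_poly_eq_sum_weight[OF that] by (simp add: Z_def w_def)
  have disj: "?L \<inter> ?R = {}" "(?L \<union> ?R) \<inter> ?f ` ?S = {}"
    using nonLeaf assms by auto
  have "BoNa_poly (Suc n) = sum w (?L \<union> ?R \<union> ?f ` ?S)"
    using BoNa_poly_eq_sum_weight[of "Suc n"] zero_one_trees_Suc[OF assms]
    by (simp add: Z_def w_def)
  also have "\<dots> = sum w ?L + sum w ?R + sum w (?f ` ?S)"
    using disj fin by (subst sum.union_disjoint; (subst sum.union_disjoint)?; auto)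
  also have "sum w ?L = BoNa_poly n"
  proof -
    have "sum w ?L = (\<Sum>l\<in>Z n. w l)"
      by (subst sum.reindex) (auto simp: inj_on_def w_def tree_weight_def)
    then show ?thesis using wB[OF assms] by simp
  qed
  also have "sum w ?R = [:0, 1:] * BoNa_poly n"
  proof -
    have "Leaf \<notin> Z n" using nonLeaf assms by blast
    then have "sum w ?R = (\<Sum>r\<in>Z n. [:0, 1:] * w r)"
      by (subst sum.reindex)
        (auto simp: inj_on_def w_def tree_weight_def monom_Suc intro!: sum.cong)
    then show ?thesis by (simp only: wB[OF assms] flip: sum_distrib_left)
  qed
  also have "sum w (?f ` ?S) = 2 * (\<Sum>i=1..<n. BoNa_poly i * BoNa_poly (n - i))"
  proof -
    have "inj_on ?f ?S" by (auto simp: inj_on_def Z_def zero_one_trees_def)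
    then have "sum w (?f ` ?S) = (\<Sum>x\<in>?S. w (?f x))" by (simp add: sum.reindex)
    also have "\<dots> = (\<Sum>(i, b, l, r)\<in>?S. w l * w r)"
    proof (rule sum.cong, rule refl, clarify)
      fix i b l r
      assume "i \<in> {1..<n}" "r \<in> Z (n - i)"
      moreover from this have "n - i \<ge> 1" by auto
      ultimately have "r \<noteq> Leaf" using nonLeaf by blast
      then show "w (Node l (Some b) r) = w l * w r"
        by (simp add: w_def tree_weight_def mult_monom)
    qed
    also have "\<dots> = (\<Sum>i=1..<n. \<Sum>b\<in>(UNIV :: bool set). \<Sum>l\<in>Z i. \<Sum>r\<in>Z (n - i). w l * w r)"
      unfolding sum.cartesian_product by (rule sum.Sigma[symmetric]) (auto simp: fin)
    also have "\<dots> = (\<Sum>i=1..<n. 2 * (BoNa_poly i * BoNa_poly (n - i)))"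
    proof (rule sum.cong)
      fix i assume "i \<in> {1..<n}"
      then have "i \<ge> 1" "n - i \<ge> 1" by auto
      then have "(\<Sum>l\<in>Z i. \<Sum>r\<in>Z (n - i). w l * w r) = BoNa_poly i * BoNa_poly (n - i)"
        by (simp only: wB flip: sum_product)
      then show "(\<Sum>b\<in>(UNIV :: bool set). \<Sum>l\<in>Z i. \<Sum>r\<in>Z (n - i). w l * w r)
          = 2 * (BoNa_poly i * BoNa_poly (n - i))" by simp
    qed simp
    finally show ?thesis by (simp add: sum_distrib_left)
  qed
  \<comment> \<open>The added end terms vanish because \<open>BoNa_poly 0 = 0\<close>; the full
    range turns the sum into a coefficient of the square of the generating function.\<close>
  also have "(\<Sum>i=1..<n. BoNa_poly i * BoNa_poly (n - i))
      = (\<Sum>i=0..n. BoNa_poly i * BoNa_poly (n - i))"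
    by (rule sum.mono_neutral_left) (auto simp: BoNa_poly_0 not_less_eq_eq le_antisym)
  finally show ?thesis by (simp add: algebra_simps)
qed

section \<open>The generating function\<close>

unbundle fps_syntax

definition BoNa_fps :: "int poly fps" where
  "BoNa_fps = Abs_fps BoNa_poly"

text \<open>Here \<open>fps_X\<close> marks vertices and \<open>[:0, 1:]\<close> is u. The constant
  coefficients vanish, the single vertex contributes u at index 1, and all later coefficients are
  the decomposition at the root.\<close>

lemma BoNa_fps_eq:
  "BoNa_fps = fps_X * (fps_const [:0, 1:] + fps_const [:1, 1:] * BoNa_fps + 2 * BoNa_fps\<^sup>2)"
proof (rule fps_ext)
  fix n
  have two: "(2 * f) $ m = 2 * f $ m" for f :: "int poly fps" and m
    by (simp add: numeral_fps_const)
  show "BoNa_fps $ n =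
      (fps_X * (fps_const [:0, 1:] + fps_const [:1, 1:] * BoNa_fps + 2 * BoNa_fps\<^sup>2)) $ n"
  proof (cases n)
    case 0
    then show ?thesis by (simp add: BoNa_fps_def BoNa_poly_0)
  next
    case (Suc m)
    show ?thesis
    proof (cases "m = 0")
      case True
      then show ?thesis
        using Suc BoNa_poly_1 by (simp add: BoNa_fps_def BoNa_poly_0 two power2_eq_square)
    next
      case False
      then have "BoNa_fps $ n = [:1, 1:] * BoNa_poly m
          + 2 * (\<Sum>i=0..m. BoNa_poly i * BoNa_poly (m - i))"
        using BoNa_poly_Suc[of m] Suc by (simp add: BoNa_fps_def)
      then show ?thesis
        using Suc False
        by (simp add: two power2_eq_square fps_mult_nth[of BoNa_fps] del: mult_pCons_left)
          (simp add: BoNa_fps_def)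
    qed
  qed
qed

text \<open>Unlike \<open>F\<^sup>2 = D\<close>, this equation is linear in \<open>F\<close>, so for
  a polynomial \<open>D\<close> it yields a recurrence of bounded length. Both sides agree after
  multiplication by \<open>F\<close>, and \<open>D \<noteq> 0\<close> forces
  \<open>F \<noteq> 0\<close>.\<close>

lemma fps_square_root_ode:
  fixes F D :: "'a::{idom, ring_char_0} fps"
  assumes "F\<^sup>2 = D" "D \<noteq> 0"
  shows "2 * D * fps_deriv F = fps_deriv D * F"
proof -
  have "F * (2 * D * fps_deriv F) = F * (fps_deriv D * F)"
    unfolding assms(1)[symmetric] by (simp add: power2_eq_square algebra_simps)
  moreover have "F \<noteq> 0" using assms by auto
  ultimately show ?thesis by simp
qed

lemma fps_square_root_quadratic_recurrence:
  fixes F :: "'a::{idom, ring_char_0} fps"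
  assumes "F\<^sup>2 = 1 - 2 * fps_const p * fps_X + fps_const q * fps_X\<^sup>2" and "m \<ge> 1"
  shows "of_nat (m + 2) * F $ (m + 2)
      = of_nat (2 * m + 1) * p * F $ (m + 1) - (of_nat m - 1) * q * F $ m"
proof -
  let ?D = "1 - 2 * fps_const p * fps_X + fps_const q * fps_X\<^sup>2"
  have "?D $ 0 = 1" by simp
  then have "?D \<noteq> 0" by (metis fps_zero_nth zero_neq_one)
  \<comment> \<open>Both \<open>D\<close> times 2 and the derivative 2(qz - p) carry a factor 2,
    which is cancelled next. The powers of \<open>fps_X\<close> are written as nested products so
    that each acts as an index shift.\<close>
  from fps_square_root_ode[OF assms(1) this]
  have "2 * (fps_deriv F - 2 * fps_const p * (fps_X * fps_deriv F)
        + fps_const q * (fps_X * (fps_X * fps_deriv F)))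
      = 2 * (fps_const q * (fps_X * F) - fps_const p * F)"
    by (simp add: power2_eq_square algebra_simps)
  then have "fps_deriv F - fps_const (2 * p) * (fps_X * fps_deriv F)
        + fps_const q * (fps_X * (fps_X * fps_deriv F))
      = fps_const q * (fps_X * F) - fps_const p * F"
    by (simp add: numeral_fps_const)
  then have "(fps_deriv F - fps_const (2 * p) * (fps_X * fps_deriv F)
        + fps_const q * (fps_X * (fps_X * fps_deriv F))) $ (m + 1)
      = (fps_const q * (fps_X * F) - fps_const p * F) $ (m + 1)"
    by (rule arg_cong)
  \<comment> \<open>The coefficient of z^j in the derivative is (j+1) times that of z^(j+1) in
    \<open>F\<close>. For the term with two factors \<open>fps_X\<close> the index is m - 1, whence
    the case split on \<open>m\<close>.\<close>
  then have "of_nat (m + 2) * F $ (m + 2) - 2 * p * (of_nat (m + 1) * F $ (m + 1))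
        + q * (of_nat m * F $ m) = q * F $ m - p * F $ (m + 1)"
    using assms(2) by (cases m) (simp_all del: of_nat_Suc add: mult.assoc)
  then show ?thesis by (simp add: algebra_simps)
qed

text \<open>Multiplying 2zB^2 - (1 - (1+u)z)B + uz = 0 by 8z and completing the square leaves (1 -
  (1+u)z)^2 - 8uz^2 on the right, and (1+u)^2 - 8u = u^2 - 6u + 1.\<close>

lemma BoNa_fps_square:
  "(4 * fps_X * BoNa_fps - 1 + fps_const [:1, 1:] * fps_X)\<^sup>2
    = 1 - 2 * fps_const [:1, 1:] * fps_X + fps_const [:1, -6, 1:] * fps_X\<^sup>2"
proof -
  define B where "B = BoNa_fps"
  define u :: "int poly fps" where "u = fps_const [:0, 1:]"
  define z :: "int poly fps" where "z = fps_X"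
  \<comment> \<open>The constants are expressed through \<open>u\<close>, so that the claim becomes
    a polynomial identity in \<open>B\<close>, \<open>u\<close> and \<open>z\<close> modulo the
    quadratic equation.\<close>
  have "[:1, 1:] = 1 + [:0, 1 :: int:]"
    by (simp add: one_pCons)
  then have one_u: "fps_const [:1, 1:] = 1 + u"
    by (simp only: u_def fps_const_add[symmetric] fps_const_1_eq_1)
  have "[:1, -6, 1:] = 1 - 6 * [:0, 1:] + [:0, 1 :: int:]\<^sup>2"
    by (simp add: power2_eq_square one_pCons numeral_poly)
  then have disc: "fps_const [:1, -6, 1:] = 1 - 6 * u + u\<^sup>2"
    by (simp only: u_def power2_eq_square numeral_fps_const fps_const_mult fps_const_sub
        fps_const_add flip: fps_const_1_eq_1)
  have "B = z * (u + (1 + u) * B + 2 * B\<^sup>2)"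
    using BoNa_fps_eq one_u by (simp add: B_def u_def z_def)
  then have "(4 * z * B - 1 + (1 + u) * z)\<^sup>2 = 1 - 2 * (1 + u) * z + (1 - 6 * u + u\<^sup>2) * z\<^sup>2"
    by algebra
  then show ?thesis by (simp only: B_def one_u disc z_def)
qed

theorem theorem6p1:
  fixes n :: nat
  assumes "n \<ge> 3"
  shows "smult (int n + 1) (BoNa_poly n) =
           smult (2 * int n - 1) ([:1, 1:] * BoNa_poly (n - 1))
         - smult (int n - 2) ([:1, -6, 1:] * BoNa_poly (n - 2))"
proof -
  define F :: "int poly fps" where "F = 4 * fps_X * BoNa_fps - 1 + fps_const [:1, 1:] * fps_X"
  define p q :: "int poly" where "p = [:1, 1:]" and "q = [:1, -6, 1:]"
  obtain k where n: "n = k + 3" using assms by (metis add.commute le_Suc_ex)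
  \<comment> \<open>The correction -1 + (1+u)z affects only the coefficients 0 and 1, hence
    \<open>j \<ge> 1\<close>.\<close>
  have F: "F $ (Suc j) = 4 * BoNa_poly j" if "j \<ge> 1" for j
    using that by (simp add: F_def BoNa_fps_def numeral_fps_const mult.assoc)
  \<comment> \<open>Since \<open>F\<close> is shifted by one against \<open>BoNa_poly\<close>, the
    recurrence is taken at m = n - 1. The lowest index is then n - 1, which by n >= 3 lies beyond
    the correction terms.\<close>
  have "of_nat (k + 2 + 2) * F $ (k + 2 + 2)
      = of_nat (2 * (k + 2) + 1) * p * F $ (k + 2 + 1) - (of_nat (k + 2) - 1) * q * F $ (k + 2)"
    using BoNa_fps_square
    by (intro fps_square_root_quadratic_recurrence) (simp_all add: F_def p_def q_def)
  then have "4 * (of_nat (k + 4) * BoNa_poly (k + 3))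
      = 4 * (of_nat (2 * k + 5) * (p * BoNa_poly (k + 2))
          - of_nat (k + 1) * (q * BoNa_poly (k + 1)))"
    using F[of "k + 3"] F[of "k + 2"] F[of "k + 1"]
    by (simp add: algebra_simps numeral_eq_Suc)
  then have "of_nat (k + 4) * BoNa_poly (k + 3) = of_nat (2 * k + 5) * (p * BoNa_poly (k + 2))
      - of_nat (k + 1) * (q * BoNa_poly (k + 1))"
    by simp
  then have "smult (int (k + 4)) (BoNa_poly (k + 3))
      = smult (int (2 * k + 5)) (p * BoNa_poly (k + 2))
        - smult (int (k + 1)) (q * BoNa_poly (k + 1))"
    by (simp only: of_nat_poly mult_smult_left mult_1_left smult_1_left) simp
  moreover have "int n + 1 = int (k + 4)" "2 * int n - 1 = int (2 * k + 5)"
    "int n - 2 = int (k + 1)" "n - 1 = k + 2" "n - 2 = k + 1"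
    using n by auto
  ultimately show ?thesis using n by (simp only: p_def q_def)
qed

end
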